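(* Let $f:\mathbb{R}^n\to[0,\infty)$ be differentiable and $\mu$-strongly convex for some $\mu>0$ (i.e. $f(x)-\frac{\mu}{2}\|x\|_2^2$ is convex), and assume that $f$ admits a sparse minimizer. Let $\tau>0$, $\alpha\in(0,1)$ and $k_i\in\mathbb{R}$. If $\alpha>|k_i|$, then the equilibrium point $(x^\star,\lambda^\star)\in\mathbb{R}^n\times\mathbb{R}^n$ of the I-ISTA iteration $$\begin{cases} x(k+1)=\mathrm{S}_{\tau\lambda(k)}\big(x(k)-\tau\nabla f(x(k))\big)\\ \lambda(k+1)=(1-\alpha)\lambda(k)+k_i\nabla f(x(k)),\end{cases}$$ that is, the pair satisfying $x^\star=\mathrm{S}_{\tau\lambda^\star}(x^\star-\tau\nabla f(x^\star))$ and $\lambda^\star=(1-\alpha)\lambda^\star+k_i\nabla f(x^\star)$, satisfies $\nabla f(x^\star)=0$ and $\lambda^\star=0$. In particular, $x^\star$ is the unique minimizer of $f$, hence it is the sparse minimizer that $f$ is assumed to admit.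
   Context: The shrinkage-thresholding operator $\mathrm{S}_{\tau\lambda}:\mathbb{R}^n\to\mathbb{R}^n$, with $\lambda=(\lambda_1,\dots,\lambda_n)$, acts componentwise: for $z\in\mathbb{R}^n$ its $j$-th component is $$\mathrm{S}_{\tau\lambda_j}(z_j)=\begin{cases} z_j-\mathrm{sign}(z_j)\,\tau\lambda_j & \text{if } |z_j|>\tau\lambda_j,\\ 0&\text{otherwise,}\end{cases}$$ with $\mathrm{sign}(0)=0$. For $\lambda_j\ge 0$ this is the proximal map $\arg\min_{u\in\mathbb{R}}\big[\tau\lambda_j|u|+\frac12(u-z_j)^2\big]$; for $\lambda_j<0$ it is defined by the displayed formula. The scalar $k_i\in\mathbb{R}$ is a single design parameter (the integral gain); the subscript $i$ is part of its name and not an index. "Sparse" means having many zero components; the only role of sparsity here is that $f$ is assumed to have some minimizer that is sparse, and the last assertion says that $x^\star$ coincides with that minimizer. *)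

theory Defs
  imports "HOL-Analysis.Analysis"
begin

definition gradient :: "(real ^ 'n \<Rightarrow> real) \<Rightarrow> real ^ 'n \<Rightarrow> real ^ 'n" where
  "gradient f x = (THE D. GDERIV f x :> D)"

(* The description is proper wherever f is differentiable. *)
lemma GDERIV_gradient:
  fixes f :: "real ^ 'n \<Rightarrow> real"
  assumes "f differentiable (at x)"
  shows "GDERIV f x :> gradient f x"
proof -
  from assms obtain f' where f': "(f has_derivative f') (at x)"
    by (auto simp: differentiable_def)
  then have lin: "linear f'"
    by (rule has_derivative_linear)
  have "f' h = inner h (adjoint f' 1)" for h
    using adjoint_works[OF lin, of h 1] by simp
  then have "f' = (\<lambda>h. inner h (adjoint f' 1))"
    by (rule ext)
  with f' have ex: "GDERIV f x :> adjoint f' 1"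
    by (simp add: gderiv_def)
  have uniq: "D = D'" if "GDERIV f x :> D" "GDERIV f x :> D'" for D D'
  proof -
    have "(\<lambda>h. inner h D) = (\<lambda>h. inner h D')"
      using that unfolding gderiv_def by (rule has_derivative_unique)
    then have "inner h D = inner h D'" for h
      by (rule fun_cong)
    then show ?thesis
      by (metis vector_eq_ldot)
  qed
  show ?thesis
    unfolding gradient_def by (rule theI[where P = "\<lambda>D. GDERIV f x :> D", OF ex]) (rule uniq[OF _ ex])
qed

definition strongly_convex :: "real \<Rightarrow> (real ^ 'n \<Rightarrow> real) \<Rightarrow> bool" where
  "strongly_convex \<mu> f \<longleftrightarrow> convex_on UNIV (\<lambda>x. f x - \<mu> / 2 * (norm x)\<^sup>2)"

abbreviation minimizer :: "(real ^ 'n \<Rightarrow> real) \<Rightarrow> real ^ 'n \<Rightarrow> bool" where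
  "minimizer f x \<equiv> is_arg_min f (\<lambda>_. True) x"

(* At most s nonzero components; s is the otherwise unspecified sparsity level. *)
definition sparse_vec :: "nat \<Rightarrow> real ^ 'n \<Rightarrow> bool" where
  "sparse_vec s x \<longleftrightarrow> card {j. x $ j \<noteq> 0} \<le> s"

(* The threshold t may be negative; then the first branch always applies, and
   the operator is not a proximal map. *)
definition soft_threshold :: "real \<Rightarrow> real \<Rightarrow> real" where
  "soft_threshold t z = (if \<bar>z\<bar> > t then z - sgn z * t else 0)"

definition shrinkage :: "real ^ 'n \<Rightarrow> real ^ 'n \<Rightarrow> real ^ 'n" where
  "shrinkage t z = (\<chi> j. soft_threshold (t $ j) (z $ j))"

definition i_ista_step ::
  "(real ^ 'n \<Rightarrow> real) \<Rightarrow> real \<Rightarrow> real \<Rightarrow> real \<Rightarrow> (real ^ 'n) \<times> (real ^ 'n) \<Rightarrow> (real ^ 'n) \<times> (real ^ 'n)" where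
  "i_ista_step f \<tau> \<alpha> k\<^sub>i = (\<lambda>(x, l).
     (shrinkage (\<tau> *\<^sub>R l) (x - \<tau> *\<^sub>R gradient f x),
      (1 - \<alpha>) *\<^sub>R l + k\<^sub>i *\<^sub>R gradient f x))"

definition i_ista_equilibrium ::
  "(real ^ 'n \<Rightarrow> real) \<Rightarrow> real \<Rightarrow> real \<Rightarrow> real \<Rightarrow> (real ^ 'n) \<times> (real ^ 'n) \<Rightarrow> bool" where
  "i_ista_equilibrium f \<tau> \<alpha> k\<^sub>i p \<longleftrightarrow> i_ista_step f \<tau> \<alpha> k\<^sub>i p = p"

end

theory Submission
  imports Defs
begin

text \<open>
  At an equilibrium the \<open>\<lambda>\<close>-equation reads \<open>\<alpha> \<lambda> = k\<^sub>i \<nabla>f(x)\<close>, so \<open>\<bar>k\<^sub>i\<bar> < \<alpha>\<close> makes every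
  nonzero component of \<open>\<nabla>f(x)\<close> strictly dominate the same component of \<open>\<lambda>\<close>. On the other hand a
  gradient step of length \<open>\<tau>\<close> that is undone by shrinkage with threshold \<open>\<tau>\<lambda>\<close> cannot have moved
  the point by more than \<open>\<tau>\<bar>\<lambda>\<bar>\<close> in any component (\<open>soft_threshold_fixed_point_bound\<close>). The two
  bounds are compatible only if \<open>\<nabla>f(x)\<close> vanishes, and then so does \<open>\<lambda>\<close>. Conversely, shrinkage
  with threshold zero is the identity, so every critical point of \<open>f\<close> paired with \<open>\<lambda> = 0\<close> is an
  equilibrium. Equilibria therefore correspond to critical points of \<open>f\<close>.

  Strong convexity takes care of the rest: the quadratic lower bound of
  \<open>strongly_convex_gradient_inequality\<close>, taken at a critical point, shows that this point is
  the only minimizer, and the assumed minimizer is itself critical.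
\<close>

lemma strongly_convex_segment:
  fixes f :: "real ^ 'n \<Rightarrow> real"
  assumes "strongly_convex \<mu> f" and "0 \<le> t" and "t \<le> 1"
  shows "f (x + t *\<^sub>R (y - x)) \<le> (1 - t) * f x + t * f y - \<mu> / 2 * (t * (1 - t)) * (norm (y - x))\<^sup>2"
proof -
  have point: "x + t *\<^sub>R (y - x) = (1 - t) *\<^sub>R x + t *\<^sub>R y"
    by (simp add: algebra_simps)
  have convex: "f ((1 - t) *\<^sub>R x + t *\<^sub>R y) - \<mu> / 2 * (norm ((1 - t) *\<^sub>R x + t *\<^sub>R y))\<^sup>2
      \<le> (1 - t) * (f x - \<mu> / 2 * (norm x)\<^sup>2) + t * (f y - \<mu> / 2 * (norm y)\<^sup>2)"
    using assms convex_onD[of UNIV "\<lambda>x. f x - \<mu> / 2 * (norm x)\<^sup>2" t x y]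
    by (simp add: strongly_convex_def)
  \<comment> \<open>In a Euclidean space the squared norm deviates from its chord by exactly this amount.\<close>
  have norm_chord: "(norm ((1 - t) *\<^sub>R x + t *\<^sub>R y))\<^sup>2
      = (1 - t) * (norm x)\<^sup>2 + t * (norm y)\<^sup>2 - t * (1 - t) * (norm (y - x))\<^sup>2"
    unfolding power2_norm_eq_inner
    by (simp add: inner_simps inner_commute[of y x] algebra_simps)
  show ?thesis
    using convex unfolding point norm_chord
    by (simp add: algebra_simps add_divide_distrib diff_divide_distrib)
qed

text \<open>
  Dividing the inequality along a segment by the step \<open>t\<close> bounds a difference quotient, and
  letting \<open>t\<close> tend to zero from the right turns that quotient into the directional derivative.
\<close>

lemma strongly_convex_gradient_inequality:
  fixes f :: "real ^ 'n \<Rightarrow> real"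
  assumes sc: "strongly_convex \<mu> f" and diff: "f differentiable (at x)"
  shows "f x + inner (y - x) (gradient f x) + \<mu> / 2 * (norm (y - x))\<^sup>2 \<le> f y"
proof -
  let ?q = "\<lambda>t. (f (x + t *\<^sub>R (y - x)) - f x) / t"
  let ?b = "\<lambda>t. f y - f x - \<mu> / 2 * (1 - t) * (norm (y - x))\<^sup>2"
  have outer: "(f has_derivative (\<lambda>h. inner h (gradient f x))) (at (x + 0 *\<^sub>R (y - x)))"
    using GDERIV_gradient[OF diff] by (simp add: gderiv_def)
  have inner_fun: "((\<lambda>t. x + t *\<^sub>R (y - x)) has_derivative (\<lambda>t. t *\<^sub>R (y - x))) (at 0)"
    by (auto intro!: derivative_eq_intros)
  have "((\<lambda>t. f (x + t *\<^sub>R (y - x))) has_derivative (\<lambda>t. inner (t *\<^sub>R (y - x)) (gradient f x))) (at 0)"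
    by (rule has_derivative_compose[OF inner_fun outer])
  then have "((\<lambda>t. f (x + t *\<^sub>R (y - x))) has_field_derivative inner (y - x) (gradient f x)) (at 0)"
    by (simp add: has_field_derivative_def mult_commute_abs)
  then have "(?q \<longlongrightarrow> inner (y - x) (gradient f x)) (at 0)"
    by (simp add: DERIV_def)
  then have lim_q: "(?q \<longlongrightarrow> inner (y - x) (gradient f x)) (at_right 0)"
    by (rule filterlim_mono) (simp_all add: at_le)
  have lim_b: "(?b \<longlongrightarrow> f y - f x - \<mu> / 2 * (1 - 0) * (norm (y - x))\<^sup>2) (at_right 0)"
    by (intro tendsto_intros)
  have "?q t \<le> ?b t" if "0 < t" "t < 1" for t
  proof -
    have "f (x + t *\<^sub>R (y - x)) - f x \<le> ?b t * t"
      using strongly_convex_segment[OF sc, of t x y] that by (simp add: algebra_simps)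
    with that(1) show ?thesis
      by (simp only: pos_divide_le_eq)
  qed
  then have "eventually (\<lambda>t. ?q t \<le> ?b t) (at_right 0)"
    unfolding eventually_at_right_field by (intro exI[of _ 1]) auto
  from tendsto_le[OF _ lim_b lim_q this] show ?thesis
    by simp
qed

lemma strongly_convex_critical_point_iff_minimizer:
  fixes f :: "real ^ 'n \<Rightarrow> real"
  assumes "\<mu> > 0" and "strongly_convex \<mu> f" and "f differentiable (at x)" and "gradient f x = 0"
  shows "minimizer f y \<longleftrightarrow> y = x"
proof -
  have lower: "f x + \<mu> / 2 * (norm (z - x))\<^sup>2 \<le> f z" for z
    using strongly_convex_gradient_inequality[OF assms(2,3), of z] assms(4) by simp
  have above: "f x < f z" if "z \<noteq> x" for z
  proof -
    have "0 < \<mu> / 2 * (norm (z - x))\<^sup>2"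
      using that assms(1) by simp
    with lower[of z] show ?thesis by linarith
  qed
  then show ?thesis
    unfolding is_arg_min_def by (metis less_asym)
qed

lemma minimizer_gradient_zero:
  fixes f :: "real ^ 'n \<Rightarrow> real"
  assumes "f differentiable (at x)" and "minimizer f x"
  shows "gradient f x = 0"
proof -
  have der: "(f has_derivative (\<lambda>h. inner h (gradient f x))) (at x)"
    using GDERIV_gradient[OF assms(1)] by (simp add: gderiv_def)
  have "\<forall>y\<in>UNIV. f x \<le> f y"
    using assms(2) by (auto simp: is_arg_min_def not_less)
  then have "(\<lambda>h. inner h (gradient f x)) = (\<lambda>h. 0)"
    using differential_zero_maxmin[OF _ open_UNIV der] by simp
  then have "inner (gradient f x) (gradient f x) = 0"
    by (rule fun_cong)
  then show ?thesis by simp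
qed

text \<open>
  Above the threshold the displacement \<open>d\<close> equals \<open>- sgn (x - d) * t\<close>; otherwise \<open>x = 0\<close>, and
  the condition for being set to zero is itself the bound. The absolute value on the right
  covers negative thresholds, for which only the first case occurs.
\<close>

lemma soft_threshold_fixed_point_bound:
  assumes "x = soft_threshold t (x - d)"
  shows "\<bar>d\<bar> \<le> \<bar>t\<bar>"
  using assms by (auto simp: soft_threshold_def sgn_if split: if_splits)

lemma shrinkage_zero: "shrinkage 0 z = z"
  by (simp add: shrinkage_def soft_threshold_def vec_eq_iff)

lemma i_ista_equilibrium_iff:
  fixes f :: "real ^ 'n \<Rightarrow> real"
  assumes "\<tau> > 0" and "\<bar>k\<bar> < \<alpha>"
  shows "i_ista_equilibrium f \<tau> \<alpha> k (x, l) \<longleftrightarrow> gradient f x = 0 \<and> l = 0"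
proof
  assume "i_ista_equilibrium f \<tau> \<alpha> k (x, l)"
  then have x: "shrinkage (\<tau> *\<^sub>R l) (x - \<tau> *\<^sub>R gradient f x) = x"
    and "(1 - \<alpha>) *\<^sub>R l + k *\<^sub>R gradient f x = l"
    by (simp_all add: i_ista_equilibrium_def i_ista_step_def)
  then have l: "\<alpha> *\<^sub>R l = k *\<^sub>R gradient f x"
    by (simp add: algebra_simps)
  have "gradient f x $ j = 0" for j
  proof -
    let ?g = "gradient f x $ j"
    have "x $ j = soft_threshold (\<tau> * l $ j) (x $ j - \<tau> * ?g)"
      using arg_cong[OF x, of "\<lambda>v. v $ j"] by (simp add: shrinkage_def)
    then have "\<tau> * \<bar>?g\<bar> \<le> \<tau> * \<bar>l $ j\<bar>"
      using soft_threshold_fixed_point_bound assms(1) by (fastforce simp: abs_mult)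
    then have "\<bar>?g\<bar> \<le> \<bar>l $ j\<bar>"
      using assms(1) by simp
    then have "\<alpha> * \<bar>?g\<bar> \<le> \<alpha> * \<bar>l $ j\<bar>"
      using assms(2) by (intro mult_left_mono) auto
    also have "\<dots> = \<bar>k\<bar> * \<bar>?g\<bar>"
    proof -
      have "\<alpha> * l $ j = k * ?g"
        using arg_cong[OF l, of "\<lambda>v. v $ j"] by simp
      then have "\<bar>\<alpha> * l $ j\<bar> = \<bar>k * ?g\<bar>" by simp
      then show ?thesis
        using assms(2) by (simp add: abs_mult)
    qed
    finally have "(\<alpha> - \<bar>k\<bar>) * \<bar>?g\<bar> \<le> 0"
      by (simp add: algebra_simps)
    then show ?thesis
      using assms(2) by (simp add: mult_le_0_iff)
  qed
  then have "gradient f x = 0"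
    by (simp add: vec_eq_iff)
  with l assms(2) show "gradient f x = 0 \<and> l = 0"
    by auto
qed (simp add: i_ista_equilibrium_def i_ista_step_def shrinkage_zero)

theorem lemma1:
  fixes f :: "real ^ 'n \<Rightarrow> real"
    and \<mu> \<tau> \<alpha> k\<^sub>i :: real
    and s :: nat
    and x\<^sub>s :: "real ^ 'n"
  assumes "\<And>x. f x \<ge> 0"
    and "\<And>x. f differentiable (at x)"
    and "\<mu> > 0" and "strongly_convex \<mu> f"
    and "minimizer f x\<^sub>s" and "sparse_vec s x\<^sub>s"
    and "\<tau> > 0" and "0 < \<alpha>" and "\<alpha> < 1"
    and "\<alpha> > \<bar>k\<^sub>i\<bar>"
  shows "(\<exists>!p. i_ista_equilibrium f \<tau> \<alpha> k\<^sub>i p) \<and>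
    (\<forall>x l. i_ista_equilibrium f \<tau> \<alpha> k\<^sub>i (x, l) \<longrightarrow>
       gradient f x = 0 \<and> l = 0 \<and>
       (\<forall>y. minimizer f y \<longleftrightarrow> y = x) \<and> x = x\<^sub>s)"
proof -
  have equilibrium: "i_ista_equilibrium f \<tau> \<alpha> k\<^sub>i (x, l) \<longleftrightarrow> gradient f x = 0 \<and> l = 0" for x l
    using assms(7,10) by (rule i_ista_equilibrium_iff)
  have critical: "minimizer f y \<longleftrightarrow> y = x" if "gradient f x = 0" for x y
    using strongly_convex_critical_point_iff_minimizer[OF assms(3,4) assms(2) that] .
  have unique: "x = x\<^sub>s" if "gradient f x = 0" for x
    using critical[OF that, THEN iffD1, OF assms(5)] by (rule sym)
  have "\<exists>!p. i_ista_equilibrium f \<tau> \<alpha> k\<^sub>i p"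
  proof (rule ex1I)
    have "gradient f x\<^sub>s = 0"
      using assms(2,5) by (rule minimizer_gradient_zero)
    then show "i_ista_equilibrium f \<tau> \<alpha> k\<^sub>i (x\<^sub>s, 0)"
      by (simp only: equilibrium)
  next
    fix p
    assume p: "i_ista_equilibrium f \<tau> \<alpha> k\<^sub>i p"
    obtain x l where xl: "p = (x, l)"
      by (rule prod.exhaust)
    with p have "gradient f x = 0" and "l = 0"
      by (simp_all only: equilibrium)
    with xl show "p = (x\<^sub>s, 0)"
      by (simp only: unique[OF \<open>gradient f x = 0\<close>])
  qed
  moreover have "gradient f x = 0 \<and> l = 0 \<and> (\<forall>y. minimizer f y \<longleftrightarrow> y = x) \<and> x = x\<^sub>s"
    if "i_ista_equilibrium f \<tau> \<alpha> k\<^sub>i (x, l)" for x l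
  proof -
    from that have "gradient f x = 0" and "l = 0"
      by (simp_all only: equilibrium)
    then show ?thesis
      by (intro conjI allI critical unique)
  qed
  ultimately show ?thesis
    by simp
qed

end
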